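(* Let $X$ be a complex Banach space with $\dim X>1$ such that its dual $X^{\ast}$ is separable, let $(J,\|\cdot\|_{J})$ be a separable admissible Banach ideal of $\mathcal{B}(X)$, and let $T\in\mathcal{B}(X)$ with adjoint $T^{\ast}\in\mathcal{B}(X^{\ast})$. Then $T^{\ast}$ satisfies the supercyclicity criterion on $X^{\ast}$ if and only if the right multiplication operator $R_{T}:J\to J$, $R_{T}(A)=AT$, is supercyclic on $(J,\|\cdot\|_{J})$.
   Context: $\mathcal{B}(X)$ is the algebra of bounded linear operators on $X$. Supercyclic: a bounded linear operator $T$ on a Banach space $Y$ is supercyclic if there is $y\in Y$ such that $\{\alpha T^{n}y:\alpha\in\mathbb{C},\,n\in\mathbb{N}\}$ is dense in $Y$. Supercyclicity criterion: a bounded linear operator $T$ on a Banach space $Y$ satisfies the supercyclicity criterion if there exist two dense subsets $D_1,D_2$ of $Y$, a sequence $(n_k)_{k\ge 0}$ of positive integers, and mappings $S_{n_k}:D_2\to Y$ such that (i) $\|T^{n_k}x\|\,\|S_{n_k}y\|\to 0$ for every $x\in D_1$ and $y\in D_2$; (ii) $T^{n_k}S_{n_k}y\to y$ for every $y\in D_2$. Rank one operators: for $x\in X$, $x^{\ast}\in X^{\ast}$, $(x\otimes x^{\ast})(z)=x^{\ast}(z)x$ for $z\in X$. $\mathcal{F}(X)$ is the linear span of the rank one operators. Banach ideal: $(J,\|\cdot\|_J)$ is a Banach ideal of $\mathcal{B}(X)$ if (i) $J\subset\mathcal{B}(X)$ is a linear subspace; (ii) $\|\cdot\|_J$ is a complete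 norm on $J$ and $\|S\|\le\|S\|_J$ for all $S\in J$; (iii) for all $S\in J$ and $A,B\in\mathcal{B}(X)$, $ASB\in J$ and $\|ASB\|_J\le\|A\|\,\|S\|_J\,\|B\|$; (iv) $x\otimes x^{\ast}\in J$ and $\|x\otimes x^{\ast}\|_J=\|x\|\,\|x^{\ast}\|$ for all $x\in X$, $x^{\ast}\in X^{\ast}$. It is admissible if $\mathcal{F}(X)$ is dense in $J$ with respect to $\|\cdot\|_J$. Separability of $J$ is with respect to $\|\cdot\|_J$. *)

theory Defs
  imports "HOL-Analysis.Analysis"
begin

section \<open>Complex normed spaces\<close>

class complex_normed_vector = real_normed_vector +
  fixes scaleC :: "complex \<Rightarrow> 'a \<Rightarrow> 'a"  (infixr "*\<^sub>C" 75)
  assumes scaleC_add_right: "a *\<^sub>C (x + y) = a *\<^sub>C x + a *\<^sub>C y"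
    and scaleC_add_left: "(a + b) *\<^sub>C x = a *\<^sub>C x + b *\<^sub>C x"
    and scaleC_scaleC: "a *\<^sub>C b *\<^sub>C x = (a * b) *\<^sub>C x"
    and scaleC_one: "1 *\<^sub>C x = x"
    and scaleR_scaleC: "r *\<^sub>R x = complex_of_real r *\<^sub>C x"
    and norm_scaleC: "norm (a *\<^sub>C x) = cmod a * norm x"

class complex_banach = complex_normed_vector + banach

global_interpretation complex_vector:
  vector_space "scaleC :: complex \<Rightarrow> 'a \<Rightarrow> 'a::complex_normed_vector"
  by standard
    (simp_all add: scaleC_add_right scaleC_add_left scaleC_scaleC scaleC_one)

lemma bounded_bilinear_scaleC:
  "bounded_bilinear (scaleC :: complex \<Rightarrow> 'a \<Rightarrow> 'a::complex_normed_vector)"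
proof
  show "\<exists>K. \<forall>a (b::'a). norm (a *\<^sub>C b) \<le> norm a * norm b * K"
    by (rule exI[of _ 1]) (simp add: norm_scaleC)
qed (simp_all add: scaleC_add_right scaleC_add_left scaleR_scaleC scaleC_scaleC
      mult.commute scaleR_conv_of_real)

instantiation complex :: complex_normed_vector
begin

definition scaleC_complex :: "complex \<Rightarrow> complex \<Rightarrow> complex"
  where "scaleC_complex a z = a * z"

instance
  by standard (simp_all add: scaleC_complex_def algebra_simps scaleR_conv_of_real norm_mult)

end

instance complex :: complex_banach ..

instantiation blinfun :: (real_normed_vector, complex_normed_vector) complex_normed_vector
begin

lift_definition scaleC_blinfun :: "complex \<Rightarrow> 'a \<Rightarrow>\<^sub>L 'b \<Rightarrow> 'a \<Rightarrow>\<^sub>L 'b"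
  is "\<lambda>a f x. a *\<^sub>C f x"
  by (rule bounded_linear_compose[OF bounded_bilinear.bounded_linear_right
        [OF bounded_bilinear_scaleC]])

instance
proof
  fix a b :: complex and r :: real and f g :: "'a \<Rightarrow>\<^sub>L 'b"
  show "a *\<^sub>C (f + g) = a *\<^sub>C f + a *\<^sub>C g"
    by transfer (simp add: scaleC_add_right)
  show "(a + b) *\<^sub>C f = a *\<^sub>C f + b *\<^sub>C f"
    by transfer (simp add: scaleC_add_left)
  show "a *\<^sub>C b *\<^sub>C f = (a * b) *\<^sub>C f"
    by transfer (simp add: scaleC_scaleC)
  show "1 *\<^sub>C f = f"
    by transfer (simp add: scaleC_one)
  show "r *\<^sub>R f = complex_of_real r *\<^sub>C f"
    by transfer (simp add: scaleR_scaleC)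
  have le: "norm (a *\<^sub>C h) \<le> cmod a * norm h" for a and h :: "'a \<Rightarrow>\<^sub>L 'b"
    by (rule norm_blinfun_bound)
      (auto simp: scaleC_blinfun.rep_eq norm_scaleC mult.assoc
        intro!: mult_left_mono norm_blinfun)
  have assoc: "c *\<^sub>C d *\<^sub>C h = (c * d) *\<^sub>C h" "1 *\<^sub>C h = h"
    for c d and h :: "'a \<Rightarrow>\<^sub>L 'b"
    by (transfer, simp add: scaleC_scaleC scaleC_one)+
  show "norm (a *\<^sub>C f) = cmod a * norm f"
  proof (cases "a = 0")
    case True
    then show ?thesis using le[of a f] by simp
  next
    case False
    have "norm f = norm (inverse a *\<^sub>C a *\<^sub>C f)"
      using False by (simp add: assoc)
    also have "\<dots> \<le> cmod (inverse a) * norm (a *\<^sub>C f)" by (rule le)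
    finally have "cmod a * norm f \<le> norm (a *\<^sub>C f)"
      using False by (simp add: norm_inverse norm_divide field_simps)
    with le[of a f] show ?thesis by simp
  qed
qed

end

text \<open>
  The type \<^typ>\<open>'a \<Rightarrow>\<^sub>L 'b\<close> consists of the real-linear bounded maps; the complex-linear ones
  form the following closed subspace. Thus \<open>clinear_ops :: ('a \<Rightarrow>\<^sub>L 'a) set\<close> is the
  algebra $\mathcal{B}(X)$ and \<open>clinear_ops :: ('a \<Rightarrow>\<^sub>L complex) set\<close> is the dual $X^*$,
  both with the operator norm.
\<close>

definition clinear_ops :: "('a::complex_normed_vector \<Rightarrow>\<^sub>L 'b::complex_normed_vector) set"
  where "clinear_ops = {A. \<forall>c x. blinfun_apply A (c *\<^sub>C x) = c *\<^sub>C blinfun_apply A x}"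

abbreviation dual_space :: "('a::complex_normed_vector \<Rightarrow>\<^sub>L complex) set"
  where "dual_space \<equiv> clinear_ops"

definition dual_adjoint ::
    "('a::complex_normed_vector \<Rightarrow>\<^sub>L 'a) \<Rightarrow> ('a \<Rightarrow>\<^sub>L complex) \<Rightarrow> ('a \<Rightarrow>\<^sub>L complex)"
  where "dual_adjoint T f = f o\<^sub>L T"

text \<open>Stated through a basis because \<open>dim\<close> is \<open>0\<close> on infinite-dimensional spaces.\<close>

definition complex_dim_gt_one :: "'a::complex_normed_vector itself \<Rightarrow> bool"
  where "complex_dim_gt_one _ \<longleftrightarrow>
    (\<exists>B::'a set. complex_vector.independent B \<and> complex_vector.span B = UNIV \<and>
       (finite B \<longrightarrow> 1 < card B))"


section \<open>Subspaces with a norm of their own\<close>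

text \<open>
  A Banach space is given by a carrier \<open>Y\<close> inside a complex vector space and a norm \<open>N\<close> that
  is meaningful on \<open>Y\<close> only. The norm of the ambient type plays no role here.
\<close>

definition complex_banach_on :: "'v::complex_normed_vector set \<Rightarrow> ('v \<Rightarrow> real) \<Rightarrow> bool"
  where "complex_banach_on Y N \<longleftrightarrow>
    complex_vector.subspace Y \<and>
    (\<forall>x\<in>Y. 0 \<le> N x) \<and>
    (\<forall>x\<in>Y. N x = 0 \<longleftrightarrow> x = 0) \<and>
    (\<forall>c. \<forall>x\<in>Y. N (c *\<^sub>C x) = cmod c * N x) \<and>
    (\<forall>x\<in>Y. \<forall>y\<in>Y. N (x + y) \<le> N x + N y) \<and>
    (\<forall>u::nat \<Rightarrow> 'v. (\<forall>n. u n \<in> Y) \<and> (\<forall>e>0. \<exists>M. \<forall>m\<ge>M. \<forall>n\<ge>M. N (u m - u n) < e) \<longrightarrow>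
       (\<exists>l\<in>Y. (\<lambda>n. N (u n - l)) \<longlonglongrightarrow> 0))"

definition bounded_op_on ::
    "'v::complex_normed_vector set \<Rightarrow> ('v \<Rightarrow> real) \<Rightarrow> ('v \<Rightarrow> 'v) \<Rightarrow> bool"
  where "bounded_op_on Y N T \<longleftrightarrow>
    (\<forall>x\<in>Y. T x \<in> Y) \<and>
    (\<forall>x\<in>Y. \<forall>y\<in>Y. T (x + y) = T x + T y) \<and>
    (\<forall>c. \<forall>x\<in>Y. T (c *\<^sub>C x) = c *\<^sub>C T x) \<and>
    (\<exists>K. \<forall>x\<in>Y. N (T x) \<le> K * N x)"

definition dense_on :: "'v::complex_normed_vector set \<Rightarrow> ('v \<Rightarrow> real) \<Rightarrow> 'v set \<Rightarrow> bool"
  where "dense_on Y N D \<longleftrightarrow> D \<subseteq> Y \<and> (\<forall>y\<in>Y. \<forall>e>0. \<exists>d\<in>D. N (y - d) < e)"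

definition separable_on :: "'v::complex_normed_vector set \<Rightarrow> ('v \<Rightarrow> real) \<Rightarrow> bool"
  where "separable_on Y N \<longleftrightarrow> (\<exists>D. countable D \<and> dense_on Y N D)"

text \<open>The two notions below are meant for \<open>complex_banach_on Y N\<close> and \<open>bounded_op_on Y N T\<close>.\<close>

definition supercyclic_on ::
    "'v::complex_normed_vector set \<Rightarrow> ('v \<Rightarrow> real) \<Rightarrow> ('v \<Rightarrow> 'v) \<Rightarrow> bool"
  where "supercyclic_on Y N T \<longleftrightarrow>
    (\<exists>y\<in>Y. dense_on Y N {a *\<^sub>C (T ^^ n) y | (a::complex) (n::nat). True})"

definition supercyclicity_criterion_on ::
    "'v::complex_normed_vector set \<Rightarrow> ('v \<Rightarrow> real) \<Rightarrow> ('v \<Rightarrow> 'v) \<Rightarrow> bool"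
  where "supercyclicity_criterion_on Y N T \<longleftrightarrow>
    (\<exists>D1 D2. \<exists>n::nat \<Rightarrow> nat. \<exists>S::nat \<Rightarrow> 'v \<Rightarrow> 'v.
       dense_on Y N D1 \<and> dense_on Y N D2 \<and>
       (\<forall>k. 0 < n k) \<and>
       (\<forall>k. \<forall>y\<in>D2. S (n k) y \<in> Y) \<and>
       (\<forall>x\<in>D1. \<forall>y\<in>D2. (\<lambda>k. N ((T ^^ n k) x) * N (S (n k) y)) \<longlonglongrightarrow> 0) \<and>
       (\<forall>y\<in>D2. (\<lambda>k. N ((T ^^ n k) (S (n k) y) - y)) \<longlonglongrightarrow> 0))"


section \<open>Banach ideals\<close>

lift_definition rank_one ::
    "'a::complex_normed_vector \<Rightarrow> ('a \<Rightarrow>\<^sub>L complex) \<Rightarrow> ('a \<Rightarrow>\<^sub>L 'a)"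
  is "\<lambda>x f z. f z *\<^sub>C x"
  by (rule bounded_linear_compose[OF bounded_bilinear.bounded_linear_left
        [OF bounded_bilinear_scaleC]])

definition finite_rank_ops :: "('a::complex_normed_vector \<Rightarrow>\<^sub>L 'a) set"
  where "finite_rank_ops = complex_vector.span {rank_one x f | x f. f \<in> dual_space}"

definition banach_ideal ::
    "('a::complex_normed_vector \<Rightarrow>\<^sub>L 'a) set \<Rightarrow> ('a \<Rightarrow>\<^sub>L 'a \<Rightarrow> real) \<Rightarrow> bool"
  where "banach_ideal J nJ \<longleftrightarrow>
    J \<subseteq> clinear_ops \<and>
    complex_banach_on J nJ \<and>
    (\<forall>S\<in>J. norm S \<le> nJ S) \<and>
    (\<forall>S\<in>J. \<forall>A\<in>clinear_ops. \<forall>B\<in>clinear_ops.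
       A o\<^sub>L S o\<^sub>L B \<in> J \<and> nJ (A o\<^sub>L S o\<^sub>L B) \<le> norm A * nJ S * norm B) \<and>
    (\<forall>x. \<forall>f\<in>dual_space. rank_one x f \<in> J \<and> nJ (rank_one x f) = norm x * norm f)"

definition admissible_banach_ideal ::
    "('a::complex_normed_vector \<Rightarrow>\<^sub>L 'a) set \<Rightarrow> ('a \<Rightarrow>\<^sub>L 'a \<Rightarrow> real) \<Rightarrow> bool"
  where "admissible_banach_ideal J nJ \<longleftrightarrow> banach_ideal J nJ \<and> dense_on J nJ finite_rank_ops"

definition right_mult :: "('a::complex_normed_vector \<Rightarrow>\<^sub>L 'a) \<Rightarrow> ('a \<Rightarrow>\<^sub>L 'a) \<Rightarrow> ('a \<Rightarrow>\<^sub>L 'a)"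
  where "right_mult T A = A o\<^sub>L T"


section \<open>The two operators are bounded operators on Banach spaces\<close>

lemma clinear_ops_subspace: "complex_vector.subspace clinear_ops"
  by (rule complex_vector.subspaceI)
    (auto simp: clinear_ops_def plus_blinfun.rep_eq zero_blinfun.rep_eq scaleC_blinfun.rep_eq
      scaleC_add_right scaleC_scaleC mult.commute)

lemma clinear_ops_compose:
  "A \<in> clinear_ops \<Longrightarrow> B \<in> clinear_ops \<Longrightarrow> A o\<^sub>L B \<in> clinear_ops"
  by (simp add: clinear_ops_def)

lemma complex_banach_on_dual:
  "complex_banach_on (dual_space :: ('a::complex_normed_vector \<Rightarrow>\<^sub>L complex) set) norm"
proof -
  have "\<exists>l\<in>dual_space. (\<lambda>n. norm (u n - l)) \<longlonglongrightarrow> 0"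
    if u: "\<forall>n. u n \<in> dual_space" and c: "\<forall>e>0. \<exists>M. \<forall>m\<ge>M. \<forall>n\<ge>M. norm (u m - u n) < e"
    for u :: "nat \<Rightarrow> 'a \<Rightarrow>\<^sub>L complex"
  proof -
    have "Cauchy u" using c by (simp add: Cauchy_def dist_norm)
    then obtain l where l: "u \<longlonglongrightarrow> l"
      using Cauchy_convergent convergent_def by blast
    have lim: "(\<lambda>n. blinfun_apply (u n) x) \<longlonglongrightarrow> blinfun_apply l x" for x
      using l by (intro tendsto_intros)
    have "blinfun_apply l (c *\<^sub>C x) = c *\<^sub>C blinfun_apply l x" for c x
    proof (rule LIMSEQ_unique[OF lim])
      have "(\<lambda>n. c * blinfun_apply (u n) x) \<longlonglongrightarrow> c * blinfun_apply l x"
        by (intro tendsto_intros lim)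
      then show "(\<lambda>n. blinfun_apply (u n) (c *\<^sub>C x)) \<longlonglongrightarrow> c *\<^sub>C blinfun_apply l x"
        using u by (simp add: clinear_ops_def scaleC_complex_def)
    qed
    then show ?thesis
      using l by (auto simp: clinear_ops_def LIM_zero_iff tendsto_norm_zero_iff)
  qed
  then show ?thesis
    using clinear_ops_subspace
    by (auto simp: complex_banach_on_def norm_scaleC norm_triangle_ineq)
qed

lemma bounded_op_on_dual_adjoint:
  assumes "T \<in> clinear_ops"
  shows "bounded_op_on dual_space norm (dual_adjoint T)"
proof -
  have "\<forall>f\<in>dual_space. norm (f o\<^sub>L T) \<le> norm T * norm f"
    by (metis norm_blinfun_compose mult.commute)
  moreover have "(c *\<^sub>C f) o\<^sub>L T = c *\<^sub>C (f o\<^sub>L T)" for c and f :: "'a \<Rightarrow>\<^sub>L complex"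
    by (rule blinfun_eqI) (simp add: scaleC_blinfun.rep_eq)
  moreover have "(f + g) o\<^sub>L T = (f o\<^sub>L T) + (g o\<^sub>L T)" for f g :: "'a \<Rightarrow>\<^sub>L complex"
    by (rule blinfun_eqI) (simp add: plus_blinfun.rep_eq)
  ultimately show ?thesis
    using clinear_ops_compose[OF _ assms]
    unfolding bounded_op_on_def dual_adjoint_def by blast
qed

lemma bounded_op_on_right_mult:
  fixes T :: "'a::complex_normed_vector \<Rightarrow>\<^sub>L 'a"
  assumes J: "banach_ideal J nJ" and T: "T \<in> clinear_ops"
  shows "bounded_op_on J nJ (right_mult T)"
proof -
  have id: "(id_blinfun :: 'a \<Rightarrow>\<^sub>L 'a) \<in> clinear_ops"
    by (simp add: clinear_ops_def)
  have comp: "id_blinfun o\<^sub>L S o\<^sub>L T = S o\<^sub>L T" for S :: "'a \<Rightarrow>\<^sub>L 'a"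
    by (rule blinfun_eqI) simp
  have "\<forall>S\<in>J. S o\<^sub>L T \<in> J"
    using J id T comp unfolding banach_ideal_def by metis
  moreover have "\<forall>S\<in>J. nJ (S o\<^sub>L T) \<le> (norm (id_blinfun :: 'a \<Rightarrow>\<^sub>L 'a) * norm T) * nJ S"
    using J id T comp unfolding banach_ideal_def by (metis mult.assoc mult.commute)
  moreover have "(c *\<^sub>C S) o\<^sub>L T = c *\<^sub>C (S o\<^sub>L T)" for c and S :: "'a \<Rightarrow>\<^sub>L 'a"
    by (rule blinfun_eqI) (simp add: scaleC_blinfun.rep_eq)
  moreover have "(R + S) o\<^sub>L T = (R o\<^sub>L T) + (S o\<^sub>L T)" for R S :: "'a \<Rightarrow>\<^sub>L 'a"
    by (rule blinfun_eqI) (simp add: plus_blinfun.rep_eq)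
  ultimately show ?thesis
    unfolding bounded_op_on_def right_mult_def by blast
qed

end

theory Submission
  imports Defs
begin

text \<open>
  Two facts connect $T^*$ on $X^*$ with $R_T$ on $J$. On rank one operators
  $R_T(x \otimes f) = x \otimes T^* f$, and for $\varphi \in X^*$ the map
  $A \mapsto \varphi \circ A$ from $J$ to $X^*$ intertwines $R_T$ with $T^*$.

  Suppose that $T^*$ satisfies the criterion with dense sets $D_1, D_2$. Because
  $\|x \otimes f\|_J = \|x\| \|f\|$, the limits of the criterion pass from $f \in D_1$,
  $g \in D_2$ to $x \otimes f$, $y \otimes g$ and then to sums of such operators. These sums are
  dense in $J$ because $J$ is admissible
  (\<open>dense_on_ideal_if_rank_one\<close>, \<open>adjoint_criterion_imp_right_mult_transitive\<close>). A rescaling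
  turns the limits into transitivity of the scaled powers of $R_T$
  (\<open>criterion_imp_transitive\<close>), and the Baire category theorem in the separable space $J$ gives
  a supercyclic vector (\<open>transitive_imp_supercyclic\<close>).

  Conversely, let $A$ be supercyclic for $R_T$ and let $\varphi_1, \varphi_2 \in X^*$ be linearly
  independent. The map $B \mapsto (\varphi_1 \circ B, \varphi_2 \circ B)$ is onto
  $X^* \oplus X^*$, since $x_1 \otimes f + x_2 \otimes g$ is sent to $(f, g)$ when
  $\varphi_i(x_j) = \delta_{ij}$. Hence, with $u = \varphi_1 \circ A$ and
  $v = \varphi_2 \circ A$, the multiples $\alpha (T^{*n} u, T^{*n} v)$ are dense in
  $X^* \oplus X^*$. Approximating the pair $(0, u)$ gives $\alpha T^{*n} u \approx 0$ and
  $T^{*n}(\alpha v) \approx u$. So $\alpha v$ is an approximate preimage of $u$ under $T^{*n}$, and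
  $\|T^{*n} u\| \|\alpha v\| = \|\alpha T^{*n} u\| \|v\|$ is small. Since everything commutes
  with the powers of $T^*$, the projective orbit of $u$ serves as both dense sets of the criterion
  (\<open>dense_pair_imp_criterion\<close>, \<open>right_mult_supercyclic_imp_adjoint_criterion\<close>).

  If $X^*$ contains no two independent functionals, then either $X^* = \{0\}$, where the criterion
  is trivial, or $X^*$ is a line. In the second case, with $\varphi$ spanning $X^*$, every $A \in J$ has the form
  $x \otimes \varphi$, so supercyclicity of $R_T$ would make $X$ one-dimensional
  (\<open>not_supercyclic_right_mult_if_dual_line\<close>).
\<close>

section \<open>Operators on a space with a norm of its own\<close>

locale banach_space_on =
  fixes Y :: "'v::complex_normed_vector set" and N :: "'v \<Rightarrow> real"
  assumes complex_banach: "complex_banach_on Y N"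
begin

lemma subspace: "complex_vector.subspace Y"
  using complex_banach by (simp add: complex_banach_on_def)

lemmas zero_mem = complex_vector.subspace_0[OF subspace]
  and add_mem = complex_vector.subspace_add[OF subspace]
  and diff_mem = complex_vector.subspace_diff[OF subspace]
  and scale_mem = complex_vector.subspace_scale[OF subspace]

lemma
  shows norm_nonneg: "x \<in> Y \<Longrightarrow> 0 \<le> N x"
    and norm_eq_0: "x \<in> Y \<Longrightarrow> N x = 0 \<longleftrightarrow> x = 0"
    and norm_scale: "x \<in> Y \<Longrightarrow> N (c *\<^sub>C x) = cmod c * N x"
    and norm_add: "x \<in> Y \<Longrightarrow> y \<in> Y \<Longrightarrow> N (x + y) \<le> N x + N y"
  using complex_banach by (auto simp: complex_banach_on_def)

lemma norm_zero: "N 0 = 0"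
  by (simp add: norm_eq_0 zero_mem)

lemma norm_diff_commute:
  assumes "x \<in> Y" "y \<in> Y"
  shows "N (x - y) = N (y - x)"
proof -
  have "y - x = (- 1) *\<^sub>C (x - y)"
    by (metis complex_vector.scale_minus_left complex_vector.scale_one minus_diff_eq)
  then show ?thesis
    using norm_scale[OF diff_mem[OF assms], of "- 1"] by simp
qed

lemma norm_diff_triangle:
  assumes "x \<in> Y" "y \<in> Y" "z \<in> Y"
  shows "N (x - z) \<le> N (x - y) + N (y - z)"
  using norm_add[of "x - y" "y - z"] assms diff_mem by simp

lemma complete:
  assumes "\<And>n. u n \<in> Y" "\<And>e. 0 < e \<Longrightarrow> \<exists>M. \<forall>m\<ge>M. \<forall>n\<ge>M. N (u m - u n) < e"
  obtains l where "l \<in> Y" "(\<lambda>n::nat. N (u n - l)) \<longlonglongrightarrow> 0"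
proof -
  have "\<forall>u::nat \<Rightarrow> 'v. (\<forall>n. u n \<in> Y) \<and> (\<forall>e>0. \<exists>M. \<forall>m\<ge>M. \<forall>n\<ge>M. N (u m - u n) < e) \<longrightarrow>
      (\<exists>l\<in>Y. (\<lambda>n. N (u n - l)) \<longlonglongrightarrow> 0)"
    using complex_banach unfolding complex_banach_on_def by (elim conjE)
  from this[rule_format, of u] show ?thesis
    using assms that by auto
qed

lemma
  assumes "bounded_op_on Y N A"
  shows op_mem: "x \<in> Y \<Longrightarrow> A x \<in> Y"
    and op_add: "x \<in> Y \<Longrightarrow> y \<in> Y \<Longrightarrow> A (x + y) = A x + A y"
    and op_scale: "x \<in> Y \<Longrightarrow> A (c *\<^sub>C x) = c *\<^sub>C A x"
  using assms by (auto simp: bounded_op_on_def)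

lemma op_zero:
  assumes "bounded_op_on Y N A"
  shows "A 0 = 0"
  using op_scale[OF assms zero_mem, of 0] by simp

lemma op_diff:
  assumes "bounded_op_on Y N A" "x \<in> Y" "y \<in> Y"
  shows "A (x - y) = A x - A y"
  using op_add[OF assms(1) diff_mem[OF assms(2,3)] assms(3)] by simp

lemma op_bound:
  assumes "bounded_op_on Y N A"
  shows "\<exists>K>0. \<forall>x\<in>Y. N (A x) \<le> K * N x"
proof -
  obtain K where K: "\<forall>x\<in>Y. N (A x) \<le> K * N x"
    using assms by (auto simp: bounded_op_on_def)
  have "N (A x) \<le> max K 1 * N x" if "x \<in> Y" for x
    using K that norm_nonneg[OF that] by (meson max.cobounded1 mult_right_mono order_trans)
  then show ?thesis
    by (intro exI[of _ "max K 1"]) simp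
qed

lemma bounded_op_on_funpow:
  assumes A: "bounded_op_on Y N A"
  shows "bounded_op_on Y N (A ^^ n)"
proof (induction n)
  case 0
  show ?case by (auto simp: bounded_op_on_def intro: exI[of _ 1])
next
  case (Suc n)
  obtain K where K: "0 < K" "\<And>x. x \<in> Y \<Longrightarrow> N (A x) \<le> K * N x"
    using op_bound[OF A] by blast
  obtain L where L: "0 < L" "\<And>x. x \<in> Y \<Longrightarrow> N ((A ^^ n) x) \<le> L * N x"
    using op_bound[OF Suc] by blast
  have "N (A ((A ^^ n) x)) \<le> (K * L) * N x" if "x \<in> Y" for x
    using K(2)[OF op_mem[OF Suc that]] L(2)[OF that] K(1)
    by (metis mult.assoc mult_left_mono order_less_imp_le order_trans)
  then show ?case
    unfolding bounded_op_on_def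
    by (auto simp: op_mem[OF Suc] op_mem[OF A] op_add[OF Suc] op_add[OF A]
        op_scale[OF Suc] op_scale[OF A] intro!: exI[of _ "K * L"])
qed

end

locale operator_on = banach_space_on Y N for Y :: "'v::complex_normed_vector set" and N +
  fixes T :: "'v \<Rightarrow> 'v"
  assumes bounded_op: "bounded_op_on Y N T"
begin

lemmas funpow_op = bounded_op_on_funpow[OF bounded_op]
  and funpow_mem = op_mem[OF bounded_op_on_funpow[OF bounded_op]]
  and funpow_plus = op_add[OF bounded_op_on_funpow[OF bounded_op]]
  and funpow_scale = op_scale[OF bounded_op_on_funpow[OF bounded_op]]
  and funpow_diff = op_diff[OF bounded_op_on_funpow[OF bounded_op]]
  and funpow_zero = op_zero[OF bounded_op_on_funpow[OF bounded_op]]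

lemma funpow_swap: "(T ^^ i) ((T ^^ j) x) = (T ^^ j) ((T ^^ i) x)"
  by (metis add.commute comp_apply funpow_add)

text \<open>
  Birkhoff's argument: the vectors whose projective orbit meets a given ball form an open set, which
  is dense by transitivity. Countably many balls suffice by separability, and a vector in the
  intersection of these sets has a dense projective orbit.
\<close>

lemma transitive_imp_supercyclic:
  assumes sep: "separable_on Y N"
    and trans: "\<And>x y e. x \<in> Y \<Longrightarrow> y \<in> Y \<Longrightarrow> 0 < e \<Longrightarrow>
      \<exists>z\<in>Y. \<exists>a n. N (z - x) < e \<and> N (a *\<^sub>C (T ^^ n) z - y) < e"
  shows "supercyclic_on Y N T"
proof -
  obtain D where D: "countable D" "D \<subseteq> Y" "\<And>y e. y \<in> Y \<Longrightarrow> 0 < e \<Longrightarrow> \<exists>d\<in>D. N (y - d) < e"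
    using sep unfolding separable_on_def dense_on_def by blast
  \<comment> \<open>A metric in the sense of \<open>Metric_space\<close> must be nonnegative and symmetric off the carrier too.\<close>
  define dst where "dst x y = (if x \<in> Y \<and> y \<in> Y then N (x - y) else 0)" for x y
  interpret M: Metric_space Y dst
  proof
    show "dst x z \<le> dst x y + dst y z" if "x \<in> Y" "y \<in> Y" "z \<in> Y" for x y z
      using that norm_diff_triangle by (simp add: dst_def)
    show "dst x y = 0 \<longleftrightarrow> x = y" if "x \<in> Y" "y \<in> Y" for x y
      using that by (simp add: dst_def norm_eq_0 diff_mem)
  qed (auto simp: dst_def norm_diff_commute norm_nonneg diff_mem)
  have complete: "M.mcomplete"
    unfolding M.mcomplete_def
  proof (intro allI impI)
    fix u assume "M.MCauchy u"
    then have u: "\<And>n. u n \<in> Y"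
      and c: "\<And>e. 0 < e \<Longrightarrow> \<exists>M. \<forall>m n. M \<le> m \<longrightarrow> M \<le> n \<longrightarrow> dst (u m) (u n) < e"
      unfolding M.MCauchy_def by auto
    have "\<exists>M. \<forall>m\<ge>M. \<forall>n\<ge>M. N (u m - u n) < e" if "0 < e" for e
      using c[OF that] u by (simp add: dst_def)
    then obtain l where l: "l \<in> Y" "(\<lambda>n. N (u n - l)) \<longlonglongrightarrow> 0"
      using complete u by blast
    have "dst (u n) l = N (u n - l)" for n
      using l u by (simp add: dst_def)
    then show "\<exists>x. limitin M.mtopology u x sequentially"
      using l u by (auto simp: M.limitin_metric_dist_null)
  qed
  define G where "G d k = {z \<in> Y. \<exists>a n. N (a *\<^sub>C (T ^^ n) z - d) < inverse (real (Suc k))}" for d k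
  let ?\<G> = "(\<lambda>(d, k). G d k) ` (D \<times> UNIV)"
  have "openin M.mtopology (G d k) \<and> M.mtopology closure_of G d k = Y" if d: "d \<in> D" for d k
  proof
    show "openin M.mtopology (G d k)"
      unfolding M.openin_mtopology
    proof (intro conjI allI impI)
      show "G d k \<subseteq> Y" by (auto simp: G_def)
      fix z assume "z \<in> G d k"
      then obtain a n where z: "z \<in> Y"
        and lt: "N (a *\<^sub>C (T ^^ n) z - d) < inverse (real (Suc k))"
        by (auto simp: G_def)
      obtain K where K: "0 < K" "\<And>x. x \<in> Y \<Longrightarrow> N ((T ^^ n) x) \<le> K * N x"
        using op_bound[OF funpow_op] by blast
      \<comment> \<open>The radius uses $|a| + 1$ in place of $|a|$ because $a$ may vanish.\<close>
      define \<epsilon> where "\<epsilon> = inverse (real (Suc k)) - N (a *\<^sub>C (T ^^ n) z - d)"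
      define r where "r = \<epsilon> / ((cmod a + 1) * K)"
      have \<epsilon>: "0 < \<epsilon>" using lt by (simp add: \<epsilon>_def)
      then have r: "0 < r" using K(1) by (simp add: r_def add_nonneg_pos)
      have "w \<in> G d k" if w: "w \<in> Y" "N (z - w) < r" for w
      proof -
        have "a *\<^sub>C (T ^^ n) w - a *\<^sub>C (T ^^ n) z = a *\<^sub>C (T ^^ n) (w - z)"
          using w z by (simp add: funpow_diff complex_vector.scale_right_diff_distrib)
        then have "N (a *\<^sub>C (T ^^ n) w - a *\<^sub>C (T ^^ n) z) = cmod a * N ((T ^^ n) (w - z))"
          using w z by (simp add: norm_scale funpow_mem diff_mem)
        also have "\<dots> \<le> cmod a * (K * N (w - z))"
          using K(2)[OF diff_mem[OF w(1) z]] by (simp add: mult_left_mono)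
        also have "\<dots> \<le> (cmod a + 1) * (K * N (w - z))"
          using K(1) norm_nonneg[OF diff_mem[OF w(1) z]] by (simp add: mult_right_mono)
        also have "\<dots> < (cmod a + 1) * (K * r)"
          using w K(1) norm_diff_commute[OF w(1) z]
          by (intro mult_strict_left_mono) (auto simp: add_nonneg_pos)
        also have "\<dots> = \<epsilon>"
          using K(1) add_nonneg_pos[of "cmod a" 1] by (simp add: r_def)
        finally have "N (a *\<^sub>C (T ^^ n) w - d) < inverse (real (Suc k))"
          using norm_diff_triangle[of "a *\<^sub>C (T ^^ n) w" "a *\<^sub>C (T ^^ n) z" d] w z d D(2)
          by (force simp: \<epsilon>_def scale_mem funpow_mem)
        then show ?thesis using w by (auto simp: G_def)
      qed
      then have "M.mball z r \<subseteq> G d k"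
        by (auto simp: dst_def split: if_splits)
      with r show "\<exists>r>0. M.mball z r \<subseteq> G d k" by blast
    qed
    have "\<exists>z\<in>G d k. N (x - z) < r" if x: "x \<in> Y" and r: "0 < r" for x r
    proof -
      obtain z a n where "z \<in> Y" "N (z - x) < min r (inverse (real (Suc k)))"
          "N (a *\<^sub>C (T ^^ n) z - d) < min r (inverse (real (Suc k)))"
        using trans[of x d "min r (inverse (real (Suc k)))"] x r d D(2) by auto
      then show ?thesis
        using x by (auto simp: G_def norm_diff_commute[of x])
    qed
    then show "M.mtopology closure_of G d k = Y"
      unfolding M.metric_closure_of by (force simp: dst_def G_def)
  qed
  then have "M.mtopology closure_of \<Inter>?\<G> = Y"
    using complete D(1) by (intro M.metric_Baire_category) auto
  then obtain z where z: "z \<in> \<Inter>?\<G>" "z \<in> Y"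
    using zero_mem by (auto simp: M.metric_closure_of set_eq_iff dest!: spec[of _ 0] spec[of _ 1])
  have "\<exists>a n. N (y - a *\<^sub>C (T ^^ n) z) < e" if y: "y \<in> Y" and e: "0 < e" for y e
  proof -
    obtain k where k: "inverse (real (Suc k)) < e / 2"
      using reals_Archimedean[of "e / 2"] e by auto
    obtain d where d: "d \<in> D" "N (y - d) < e / 2"
      using D(3)[OF y, of "e / 2"] e by auto
    then have "z \<in> G d k" using z by auto
    then obtain a n where an: "N (a *\<^sub>C (T ^^ n) z - d) < e / 2"
      using k unfolding G_def by (blast intro: less_trans)
    have "N (y - a *\<^sub>C (T ^^ n) z) \<le> N (y - d) + N (d - a *\<^sub>C (T ^^ n) z)"
      using norm_diff_triangle y d(1) D(2) z by (auto simp: scale_mem funpow_mem)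
    also have "N (d - a *\<^sub>C (T ^^ n) z) = N (a *\<^sub>C (T ^^ n) z - d)"
      using d(1) D(2) z by (intro norm_diff_commute) (auto simp: scale_mem funpow_mem)
    finally show ?thesis
      using an d by (intro exI[of _ a] exI[of _ n]) simp
  qed
  then have "dense_on Y N {a *\<^sub>C (T ^^ n) z | a n. True}"
    using z(2) unfolding dense_on_def by (blast intro: scale_mem funpow_mem)
  with z show ?thesis
    unfolding supercyclic_on_def by blast
qed

text \<open>
  If $\|T^n x\| \|s\|$ is small, there is a scale $r > 0$ for which $r \|s\|$ and $\|T^n x\| / r$
  are both small. Then $z = x + r s$ is close to $x$ while $r^{-1} T^n z = r^{-1} T^n x + T^n s$ is
  close to $y$.
\<close>

lemma criterion_imp_transitive:
  assumes D1: "dense_on Y N D1" and D2: "dense_on Y N D2"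
    and inv: "\<And>x y e. x \<in> D1 \<Longrightarrow> y \<in> D2 \<Longrightarrow> 0 < e \<Longrightarrow>
      \<exists>n. \<exists>s\<in>Y. N ((T ^^ n) x) * N s < e \<and> N ((T ^^ n) s - y) < e"
    and x: "x \<in> Y" and y: "y \<in> Y" and e: "0 < e"
  shows "\<exists>z\<in>Y. \<exists>a n. N (z - x) < e \<and> N (a *\<^sub>C (T ^^ n) z - y) < e"
proof -
  define \<delta> where "\<delta> = e / 3"
  have \<delta>: "0 < \<delta>" using e by (simp add: \<delta>_def)
  obtain x' where x': "x' \<in> D1" "x' \<in> Y" "N (x - x') < \<delta>"
    using D1 x \<delta> unfolding dense_on_def by blast
  obtain y' where y': "y' \<in> D2" "y' \<in> Y" "N (y - y') < \<delta>"
    using D2 y \<delta> unfolding dense_on_def by blast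
  obtain n s where s: "s \<in> Y" "N ((T ^^ n) x') * N s < min \<delta> (\<delta> * \<delta>)"
      "N ((T ^^ n) s - y') < min \<delta> (\<delta> * \<delta>)"
    using inv[OF x'(1) y'(1), of "min \<delta> (\<delta> * \<delta>)"] \<delta> by auto
  define a where "a = N ((T ^^ n) x')"
  define b where "b = N s"
  have ab: "0 \<le> a" "0 \<le> b" "a * b < \<delta> * \<delta>"
    using s x' by (auto simp: a_def b_def norm_nonneg funpow_mem)
  obtain r where r: "0 < r" "r * b < \<delta>" "a / r \<le> \<delta>"
  proof (cases "a = 0")
    case True
    have "\<delta> / (b + 1) * b < \<delta>"
      using \<delta> ab(2) by (simp add: field_simps)
    then show ?thesis
      using that[of "\<delta> / (b + 1)"] True \<delta> ab(2) by (simp add: add_nonneg_pos)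
  next
    case False
    then have "a / \<delta> * b < \<delta>"
      using \<delta> ab(3) by (simp add: field_simps)
    then show ?thesis
      using that[of "a / \<delta>"] False \<delta> ab(1) by simp
  qed
  define z where "z = x' + complex_of_real r *\<^sub>C s"
  have z: "z \<in> Y" using x' s by (simp add: z_def add_mem scale_mem)
  have "N (z - x) \<le> N (z - x') + N (x' - x)"
    using norm_diff_triangle z x x' by blast
  also have "N (z - x') = r * b"
    using r s by (simp add: z_def norm_scale b_def)
  also have "N (x' - x) = N (x - x')"
    using norm_diff_commute x x' by blast
  finally have 1: "N (z - x) < e"
    using r x' \<delta> by (simp add: \<delta>_def)
  let ?c = "complex_of_real (1 / r)"
  have "?c *\<^sub>C (T ^^ n) z = ?c *\<^sub>C (T ^^ n) x' + (T ^^ n) s"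
    using x' s r by (simp add: z_def funpow_plus funpow_scale scale_mem scaleC_add_right
        scaleC_scaleC scaleC_one flip: of_real_mult)
  then have eq: "?c *\<^sub>C (T ^^ n) z - y = ?c *\<^sub>C (T ^^ n) x' + (((T ^^ n) s - y') + (y' - y))"
    by simp
  have mem: "?c *\<^sub>C (T ^^ n) x' \<in> Y" "(T ^^ n) s - y' \<in> Y" "y' - y \<in> Y"
    using x' s y y' by (auto simp: scale_mem funpow_mem diff_mem)
  have "N (?c *\<^sub>C (T ^^ n) z - y) \<le> N (?c *\<^sub>C (T ^^ n) x') + (N ((T ^^ n) s - y') + N (y' - y))"
    unfolding eq using mem norm_add[OF mem(1) add_mem[OF mem(2,3)]] norm_add[OF mem(2,3)] by simp
  also have "N (?c *\<^sub>C (T ^^ n) x') = a / r"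
    using x' r(1) by (simp add: norm_scale funpow_mem a_def norm_divide)
  also have "N (y' - y) = N (y - y')"
    using norm_diff_commute y y' by blast
  finally have "N (?c *\<^sub>C (T ^^ n) z - y) < e"
    using r(3) s(3) y'(3) unfolding min_less_iff_conj \<delta>_def by linarith
  with 1 z show ?thesis by blast
qed

text \<open>
  Approximating $(0, u)$ by $\alpha (T^n u, T^n v)$ makes $w = \alpha v$ an approximate preimage
  of $u$ under $T^n$ with $\|T^n u\| \|w\|$ small, which is the criterion at $u$ itself. The map
  $c T^j u \mapsto c T^j w$ transports it to the orbit of $u$. The criterion attaches one map to
  each exponent, so the chosen exponents must be distinct; therefore the proof shows that every
  single exponent yields only a limited accuracy (\<open>single\<close>), which forces good approximations to
  occur at arbitrarily large exponents.
\<close>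

lemma dense_pair_imp_criterion:
  assumes u: "u \<in> Y" and v: "v \<in> Y"
    and dense: "\<And>x y e. x \<in> Y \<Longrightarrow> y \<in> Y \<Longrightarrow> 0 < e \<Longrightarrow>
      \<exists>a n. N (a *\<^sub>C (T ^^ n) u - x) < e \<and> N (a *\<^sub>C (T ^^ n) v - y) < e"
  shows "supercyclicity_criterion_on Y N T"
proof (cases "u = 0")
  case True
  have "y = 0" if y: "y \<in> Y" for y
  proof -
    have "N (- y) < e" if "0 < e" for e
      using dense[OF y y that] True by (auto simp: funpow_zero)
    then have "N (- y) \<le> 0" by (meson less_irrefl not_le)
    then show ?thesis
      using y norm_diff_commute[OF zero_mem y] norm_nonneg[OF y] norm_eq_0[OF y] by simp
  qed
  then have "Y = {0}" using zero_mem by blast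
  then show ?thesis
    unfolding supercyclicity_criterion_on_def dense_on_def
    by (intro exI[of _ "{0}"] exI[of _ "\<lambda>_. 1"] exI[of _ "\<lambda>_ _. 0"])
      (auto simp: norm_zero op_zero[OF bounded_op])
next
  case False
  define close where
    "close \<delta> a n \<longleftrightarrow> N (a *\<^sub>C (T ^^ n) u) < \<delta> \<and> N (a *\<^sub>C (T ^^ n) v - u) < \<delta>" for \<delta> a n
  have mem: "a *\<^sub>C (T ^^ n) u \<in> Y" "a *\<^sub>C (T ^^ n) v \<in> Y" for a n
    using u v by (auto simp: scale_mem funpow_mem)
  have Nu: "0 < N u"
    using False u norm_nonneg norm_eq_0 by (metis order_le_less)
  have single: "\<exists>\<delta>>0. \<forall>a. \<not> close \<delta> a n" for n
  proof (cases "(T ^^ n) u = 0")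
    case True
    obtain K where K: "0 < K" "\<And>x. x \<in> Y \<Longrightarrow> N ((T ^^ n) x) \<le> K * N x"
      using op_bound[OF funpow_op] by blast
    \<comment> \<open>$T^n$ vanishes on the orbit of $u$, hence at $v$, which is a limit of multiples of that orbit.\<close>
    have "N ((T ^^ n) v) < e" if e: "0 < e" for e
    proof -
      obtain b j where "N (b *\<^sub>C (T ^^ j) u - v) < e / K"
        using dense[OF v v, of "e / K"] K(1) e by auto
      then have "K * N (b *\<^sub>C (T ^^ j) u - v) < e"
        using K(1) by (simp add: field_simps)
      moreover have "(T ^^ n) (b *\<^sub>C (T ^^ j) u - v) = 0 - (T ^^ n) v"
        using u v mem by (simp add: funpow_diff funpow_scale funpow_mem funpow_swap[of n] True
            funpow_zero)
      ultimately show ?thesis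
        using K(2)[OF diff_mem[OF mem(1) v], of b j] norm_diff_commute[OF zero_mem funpow_mem[OF v]]
        by force
    qed
    then have "(T ^^ n) v = 0"
      using norm_nonneg[OF funpow_mem[OF v]] norm_eq_0[OF funpow_mem[OF v]]
      by (metis less_irrefl order_le_less)
    then have "\<not> close (N u) a n" for a
      using u norm_diff_commute[OF zero_mem u] by (simp add: close_def)
    then show ?thesis using Nu by blast
  next
    case False
    \<comment> \<open>If $|\alpha| p < \delta$ then $\|\alpha T^n v\| \leq \delta q / p$, which
        is too small for $\alpha T^n v$ to lie within $\delta$ of $u$ once $\delta (1 + q / p) = N u$.\<close>
    define p where "p = N ((T ^^ n) u)"
    define q where "q = N ((T ^^ n) v)"
    have p: "0 < p" and q: "0 \<le> q"
      using False u v norm_nonneg norm_eq_0 funpow_mem unfolding p_def q_def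
      by (metis order_le_less)+
    define \<delta> where "\<delta> = N u / (1 + q / p)"
    have \<delta>: "0 < \<delta>" "\<delta> * (1 + q / p) = N u"
      using p q Nu add_pos_nonneg[of 1 "q / p"] by (auto simp: \<delta>_def)
    have "\<not> close \<delta> a n" for a
    proof
      assume "close \<delta> a n"
      then have a: "cmod a * p < \<delta>" "N (a *\<^sub>C (T ^^ n) v - u) < \<delta>"
        using u by (auto simp: close_def p_def norm_scale funpow_mem)
      have "N u \<le> N (u - a *\<^sub>C (T ^^ n) v) + N (a *\<^sub>C (T ^^ n) v)"
        using norm_add[OF diff_mem[OF u mem(2)] mem(2), of a n a n] by simp
      also have "N (u - a *\<^sub>C (T ^^ n) v) < \<delta>"
        using a norm_diff_commute[OF u mem(2)] by simp
      also have "N (a *\<^sub>C (T ^^ n) v) = cmod a * p * (q / p)"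
        using v p by (simp add: q_def norm_scale funpow_mem)
      also have "\<dots> \<le> \<delta> * (q / p)"
        using a p q by (intro mult_right_mono) auto
      finally show False
        using \<delta>(2) by (simp add: algebra_simps)
    qed
    with \<delta>(1) show ?thesis by blast
  qed
  have initial: "\<exists>\<delta>>0. \<forall>n<M. \<forall>a. \<not> close \<delta> a n" for M
  proof (induction M)
    case (Suc M)
    then obtain \<delta>1 where \<delta>1: "0 < \<delta>1" "\<forall>n<M. \<forall>a. \<not> close \<delta>1 a n" by blast
    obtain \<delta>2 where \<delta>2: "0 < \<delta>2" "\<forall>a. \<not> close \<delta>2 a M" using single by blast
    show ?case
      using \<delta>1 \<delta>2 by (intro exI[of _ "min \<delta>1 \<delta>2"]) (auto simp: close_def less_Suc_eq)
  qed (auto intro: exI[of _ 1])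
  have late: "\<exists>n>M. \<exists>a. close \<epsilon> a n" if \<epsilon>: "0 < \<epsilon>" for \<epsilon> M
  proof -
    obtain \<delta> where \<delta>: "0 < \<delta>" "\<forall>n<Suc M. \<forall>a. \<not> close \<delta> a n" using initial by blast
    obtain a n where "close (min \<epsilon> \<delta>) a n"
      using dense[OF zero_mem u, of "min \<epsilon> \<delta>"] \<epsilon> \<delta>(1) by (auto simp: close_def)
    then have "close \<epsilon> a n" "close \<delta> a n" by (auto simp: close_def)
    then show ?thesis using \<delta>(2) by (meson not_less_eq)
  qed
  have "\<exists>n. \<forall>k. (0 < n k \<and> (\<exists>a. close (inverse (real (Suc k))) a (n k))) \<and> n k < n (Suc k)"
    by (rule dependent_nat_choice)
      (use late in \<open>(metis gr_zeroI less_trans not_less0 inverse_positive_iff_positive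
        of_nat_0_less_iff zero_less_Suc)+\<close>)
  then obtain n a where n: "\<And>k. 0 < n k" "\<And>k. n k < n (Suc k)"
      and close: "\<And>k. close (inverse (real (Suc k))) (a k) (n k)"
    by metis
  have inj: "inv n (n k) = k" for k
    using n(2) by (simp add: strict_mono_Suc_iff strict_mono_imp_inj_on inv_f_f)
  define P where "P = {c *\<^sub>C (T ^^ j) u | c j. True}"
  have P_dense: "dense_on Y N P"
    unfolding dense_on_def
  proof (intro conjI ballI allI impI)
    show "P \<subseteq> Y" using mem by (auto simp: P_def)
    show "\<exists>d\<in>P. N (y - d) < e" if "y \<in> Y" "0 < e" for y e
      using dense[OF that(1) that(1) that(2)] norm_diff_commute[OF that(1) mem(1)]
      by (force simp: P_def)
  qed
  have "\<forall>y\<in>P. \<exists>c j. y = c *\<^sub>C (T ^^ j) u"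
    by (auto simp: P_def)
  then obtain c j where rep: "\<And>y. y \<in> P \<Longrightarrow> y = c y *\<^sub>C (T ^^ j y) u"
    by metis
  \<comment> \<open>The representation $y = c T^j u$ need not be unique, so one is fixed for each $y$.\<close>
  define S where "S m y = c y *\<^sub>C (T ^^ j y) (a (inv n m) *\<^sub>C v)" for m y
  have S_mem: "S m y \<in> Y" for m y
    using v by (simp add: S_def scale_mem funpow_mem)
  have lim0: "f \<longlonglongrightarrow> 0"
    if "\<And>k. 0 \<le> f k" "\<And>k. f k \<le> C * inverse (real (Suc k))" for f :: "nat \<Rightarrow> real" and C
  proof (rule tendsto_sandwich[OF _ _ tendsto_const])
    show "(\<lambda>k. C * inverse (real (Suc k))) \<longlonglongrightarrow> 0"
      using tendsto_mult_right_zero[OF LIMSEQ_inverse_real_of_nat] .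
  qed (use that in auto)
  have "(\<lambda>k. N ((T ^^ n k) x) * N (S (n k) y)) \<longlonglongrightarrow> 0" if x: "x \<in> P" and y: "y \<in> P" for x y
  proof -
    obtain K where K: "0 < K" "\<And>w. w \<in> Y \<Longrightarrow> N ((T ^^ j x) w) \<le> K * N w"
      using op_bound[OF funpow_op] by blast
    define q where "q = N ((T ^^ j y) v)"
    have q: "0 \<le> q" using v by (simp add: q_def norm_nonneg funpow_mem)
    show ?thesis
    proof (rule lim0[of _ "cmod (c x) * K * cmod (c y) * q"])
      fix k
      have Tx: "(T ^^ n k) x = c x *\<^sub>C (T ^^ j x) ((T ^^ n k) u)"
        using arg_cong[OF rep[OF x], of "T ^^ n k"] u
        by (simp add: funpow_scale funpow_mem funpow_swap[of "n k"])
      have "N ((T ^^ n k) x) \<le> cmod (c x) * (K * N ((T ^^ n k) u))"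
        unfolding Tx using K(2)[OF funpow_mem[OF u, of "n k"]] u
        by (simp add: norm_scale funpow_mem mult_left_mono)
      moreover have Sy: "N (S (n k) y) = cmod (c y) * (cmod (a k) * q)"
        using v by (simp add: S_def inj funpow_scale norm_scale funpow_mem scale_mem q_def norm_mult)
      ultimately have "N ((T ^^ n k) x) * N (S (n k) y)
          \<le> cmod (c x) * (K * N ((T ^^ n k) u)) * (cmod (c y) * (cmod (a k) * q))"
        using q by (simp add: mult_right_mono)
      also have "\<dots> = (cmod (c x) * K * cmod (c y) * q) * N (a k *\<^sub>C (T ^^ n k) u)"
        using u by (simp add: norm_scale funpow_mem mult_ac)
      also have "\<dots> \<le> (cmod (c x) * K * cmod (c y) * q) * inverse (real (Suc k))"
        using close[of k] K(1) q unfolding close_def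
        by (intro mult_left_mono mult_nonneg_nonneg) auto
      finally show "N ((T ^^ n k) x) * N (S (n k) y)
          \<le> cmod (c x) * K * cmod (c y) * q * inverse (real (Suc k))" .
      show "0 \<le> N ((T ^^ n k) x) * N (S (n k) y)"
        unfolding Tx using u S_mem by (simp add: norm_nonneg scale_mem funpow_mem)
    qed
  qed
  moreover have "(\<lambda>k. N ((T ^^ n k) (S (n k) y) - y)) \<longlonglongrightarrow> 0" if y: "y \<in> P" for y
  proof -
    obtain K where K: "0 < K" "\<And>w. w \<in> Y \<Longrightarrow> N ((T ^^ j y) w) \<le> K * N w"
      using op_bound[OF funpow_op] by blast
    show ?thesis
    proof (rule lim0[of _ "cmod (c y) * K"])
      fix k
      let ?w = "a k *\<^sub>C (T ^^ n k) v - u"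
      have w: "?w \<in> Y" using mem u by (simp add: diff_mem)
      have "(T ^^ n k) (S (n k) y) = c y *\<^sub>C (T ^^ j y) (a k *\<^sub>C (T ^^ n k) v)"
        using v by (simp add: S_def inj funpow_scale funpow_mem scale_mem funpow_swap[of "n k"])
      then have eq: "(T ^^ n k) (S (n k) y) - y = c y *\<^sub>C (T ^^ j y) ?w"
        using rep[OF y] mem u by (simp add: funpow_diff complex_vector.scale_right_diff_distrib)
      have "N ((T ^^ n k) (S (n k) y) - y) = cmod (c y) * N ((T ^^ j y) ?w)"
        unfolding eq using w by (simp add: norm_scale funpow_mem)
      also have "\<dots> \<le> cmod (c y) * (K * inverse (real (Suc k)))"
        using K w close[of k] unfolding close_def
        by (meson less_imp_le mult_left_mono norm_ge_zero order_trans)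
      finally show "N ((T ^^ n k) (S (n k) y) - y) \<le> cmod (c y) * K * inverse (real (Suc k))"
        by (simp add: mult.assoc)
      show "0 \<le> N ((T ^^ n k) (S (n k) y) - y)"
        unfolding eq using w by (simp add: norm_nonneg scale_mem funpow_mem)
    qed
  qed
  ultimately show ?thesis
    unfolding supercyclicity_criterion_on_def using n(1) S_mem P_dense
    by (intro exI[of _ P] exI[of _ n] exI[of _ S]) blast
qed

end


section \<open>Rank one operators intertwine right multiplication and the adjoint\<close>

lemma banach_idealD:
  assumes "banach_ideal J nJ"
  shows banach_ideal_subset: "J \<subseteq> clinear_ops"
    and banach_ideal_banach: "complex_banach_on J nJ"
    and banach_ideal_norm_le: "S \<in> J \<Longrightarrow> norm S \<le> nJ S"
    and banach_ideal_rank_one: "f \<in> dual_space \<Longrightarrow> rank_one x f \<in> J"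
    and banach_ideal_norm_rank_one: "f \<in> dual_space \<Longrightarrow> nJ (rank_one x f) = norm x * norm f"
  using assms by (auto simp: banach_ideal_def)

lemma operator_on_right_mult:
  assumes "banach_ideal J nJ" "T \<in> clinear_ops"
  shows "operator_on J nJ (right_mult T)"
  using assms by unfold_locales (auto intro: banach_ideal_banach bounded_op_on_right_mult)

lemma operator_on_dual_adjoint:
  assumes "T \<in> clinear_ops"
  shows "operator_on dual_space norm (dual_adjoint T)"
  using assms by unfold_locales (auto intro: complex_banach_on_dual bounded_op_on_dual_adjoint)

lemmas clinear_ops_diff = complex_vector.subspace_diff[OF clinear_ops_subspace]

lemma rank_one_diff: "rank_one x f - rank_one x g = rank_one x (f - g)"
  by (rule blinfun_eqI)
    (simp add: rank_one.rep_eq minus_blinfun.rep_eq complex_vector.scale_left_diff_distrib)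

lemma scaleC_rank_one: "c *\<^sub>C rank_one x f = rank_one (c *\<^sub>C x) f"
  by (rule blinfun_eqI) (simp add: rank_one.rep_eq scaleC_blinfun.rep_eq scaleC_scaleC mult.commute)

lemma right_mult_funpow_rank_one:
  "(right_mult T ^^ n) (rank_one x f) = rank_one x ((dual_adjoint T ^^ n) f)"
proof (induction n)
  case (Suc n)
  have "right_mult T (rank_one x g) = rank_one x (dual_adjoint T g)" for g
    by (rule blinfun_eqI) (simp add: rank_one.rep_eq right_mult_def dual_adjoint_def)
  with Suc show ?case by simp
qed simp

lemma dual_adjoint_funpow_compose:
  "(dual_adjoint T ^^ n) (\<phi> o\<^sub>L A) = \<phi> o\<^sub>L (right_mult T ^^ n) A"
proof (induction n)
  case (Suc n)
  have "dual_adjoint T (\<phi> o\<^sub>L B) = \<phi> o\<^sub>L right_mult T B" for B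
    by (rule blinfun_eqI) (simp add: right_mult_def dual_adjoint_def)
  with Suc show ?case by simp
qed simp

text \<open>
  The operators in $J$ that \<open>G\<close> approximates include $x \otimes f$ for every $f \in X^*$, because
  $\|x \otimes (f - g)\|_J = \|x\| \|f - g\|$. They are closed under sums, and a scalar can be
  absorbed into $x$, so they contain the finite rank operators and hence are all of $J$.
\<close>

lemma dense_on_ideal_if_rank_one:
  assumes adm: "admissible_banach_ideal J nJ" and D: "dense_on dual_space norm D"
    and G: "G \<subseteq> J" "0 \<in> G" "\<And>A B. A \<in> G \<Longrightarrow> B \<in> G \<Longrightarrow> A + B \<in> G"
      "\<And>x f. f \<in> D \<Longrightarrow> rank_one x f \<in> G"
  shows "dense_on J nJ G"
proof -
  have J: "banach_ideal J nJ" and fin: "dense_on J nJ finite_rank_ops"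
    using adm by (auto simp: admissible_banach_ideal_def)
  interpret banach_space_on J nJ
    using J by unfold_locales (rule banach_ideal_banach)
  have approx: "A \<in> J \<and> (\<forall>e>0. \<exists>B\<in>G. nJ (A - B) < e)" if "A \<in> finite_rank_ops" for A
    using that unfolding finite_rank_ops_def
  proof (induction rule: complex_vector.span_induct_alt)
    case base
    show ?case using G(2) zero_mem norm_zero by (metis diff_self)
  next
    case (step c R A)
    then obtain x f where R: "c *\<^sub>C R = rank_one (c *\<^sub>C x) f" and f: "f \<in> dual_space"
      by (auto simp: scaleC_rank_one)
    define x' where "x' = c *\<^sub>C x"
    have A: "A \<in> J" using step by blast
    have RJ: "rank_one x' f \<in> J" using J f by (rule banach_ideal_rank_one)
    have "\<exists>B\<in>G. nJ (rank_one x' f + A - B) < e" if e: "0 < e" for e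
    proof -
      have pos: "0 < norm x' + 1" by (simp add: add_nonneg_pos)
      then obtain g where g: "g \<in> D" "g \<in> dual_space" "norm (f - g) < e / 2 / (norm x' + 1)"
        using D f e unfolding dense_on_def by (meson divide_pos_pos half_gt_zero subsetD)
      obtain B where B: "B \<in> G" "nJ (A - B) < e / 2"
        using step e half_gt_zero by blast
      have "nJ (rank_one x' f - rank_one x' g) = norm x' * norm (f - g)"
        using J f g
        by (simp add: clinear_ops_diff rank_one_diff banach_ideal_norm_rank_one[OF J])
      also have "\<dots> \<le> (norm x' + 1) * norm (f - g)"
        by (simp add: mult_right_mono)
      also have "\<dots> < e / 2"
        using g(3) pos by (simp add: field_simps)
      finally have "nJ (rank_one x' f - rank_one x' g) + nJ (A - B) < e"
        using B by simp
      moreover have "rank_one x' g \<in> J"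
        using J g by (auto intro: banach_ideal_rank_one)
      ultimately have "nJ ((rank_one x' f - rank_one x' g) + (A - B)) < e"
        using norm_add[of "rank_one x' f - rank_one x' g" "A - B"] RJ A B(1) G(1)
          diff_mem by fastforce
      moreover have "rank_one x' g + B \<in> G"
        using g B G by blast
      ultimately show ?thesis
        by (intro bexI[of _ "rank_one x' g + B"]) (simp_all add: algebra_simps)
    qed
    then show ?case
      unfolding R using A RJ by (simp add: x'_def add_mem)
  qed
  show ?thesis
    unfolding dense_on_def
  proof (intro conjI ballI allI impI G(1))
    fix A and e :: real
    assume A: "A \<in> J" and e: "0 < e"
    obtain F where F: "F \<in> finite_rank_ops" "nJ (A - F) < e / 2"
      using fin A e unfolding dense_on_def by (meson half_gt_zero)
    obtain B where B: "B \<in> G" "nJ (F - B) < e / 2"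
      using approx[OF F(1)] e half_gt_zero by blast
    have "nJ (A - B) < e"
      using norm_diff_triangle[of A F B] A approx[OF F(1)] B F G(1) by auto
    with B show "\<exists>B\<in>G. nJ (A - B) < e" by blast
  qed
qed

section \<open>From the criterion to a supercyclic multiplication\<close>

text \<open>
  Dense sets for $R_T$ are obtained without writing finite rank operators as explicit sums.
  \<open>G1\<close> collects all $A$ for which $\|R_T^{n_k} A\|_J \|S_{n_k} g\| \to 0$ for each $g \in D_2$;
  \<open>G2\<close> collects all $B$ with approximate preimages $s_k$ under $R_T^{n_k}$ that satisfy
  $\|R_T^{n_k} A\|_J \|s_k\|_J \to 0$ for each $A$ in \<open>G1\<close>. Both sets are closed under sums, and they
  contain the rank one operators built from $D_1$ and from $D_2$ respectively.
\<close>

lemma adjoint_criterion_imp_right_mult_transitive: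
  assumes adm: "admissible_banach_ideal J nJ" and T: "T \<in> clinear_ops"
    and crit: "supercyclicity_criterion_on dual_space norm (dual_adjoint T)"
    and AB: "A0 \<in> J" "B0 \<in> J" "0 < e"
  shows "\<exists>Z\<in>J. \<exists>a n. nJ (Z - A0) < e \<and> nJ (a *\<^sub>C (right_mult T ^^ n) Z - B0) < e"
proof -
  have J: "banach_ideal J nJ"
    using adm by (simp add: admissible_banach_ideal_def)
  interpret operator_on J nJ "right_mult T"
    using J T by (rule operator_on_right_mult)
  obtain D1 D2 n S where D: "dense_on dual_space norm D1" "dense_on dual_space norm D2"
    and S: "\<And>k g. g \<in> D2 \<Longrightarrow> S (n k) g \<in> dual_space"
    and lim1: "\<And>f g. f \<in> D1 \<Longrightarrow> g \<in> D2 \<Longrightarrow>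
        (\<lambda>k. norm ((dual_adjoint T ^^ n k) f) * norm (S (n k) g)) \<longlonglongrightarrow> 0"
    and lim2: "\<And>g. g \<in> D2 \<Longrightarrow> (\<lambda>k. norm ((dual_adjoint T ^^ n k) (S (n k) g) - g)) \<longlonglongrightarrow> 0"
    using crit unfolding supercyclicity_criterion_on_def by blast
  have D_dual: "f \<in> dual_space" if "f \<in> D1 \<or> f \<in> D2" for f
    using that D by (auto simp: dense_on_def)
  have adj_mem: "(dual_adjoint T ^^ k) f \<in> dual_space" if "f \<in> dual_space" for k f
    using operator_on.funpow_mem[OF operator_on_dual_adjoint[OF T] that] .
  define G1 where
    "G1 = {A \<in> J. \<forall>g\<in>D2. (\<lambda>k. nJ ((right_mult T ^^ n k) A) * norm (S (n k) g)) \<longlonglongrightarrow> 0}"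
  define G2 where "G2 = {B \<in> J. \<exists>s. (\<forall>k. s k \<in> J) \<and>
      (\<forall>A\<in>G1. (\<lambda>k. nJ ((right_mult T ^^ n k) A) * nJ (s k)) \<longlonglongrightarrow> 0) \<and>
      (\<lambda>k. nJ ((right_mult T ^^ n k) (s k) - B)) \<longlonglongrightarrow> 0}"
  have "dense_on J nJ G1"
  proof (rule dense_on_ideal_if_rank_one[OF adm D(1)])
    show "G1 \<subseteq> J" by (auto simp: G1_def)
    show "0 \<in> G1" by (simp add: G1_def zero_mem funpow_zero norm_zero)
    show "A + B \<in> G1" if A: "A \<in> G1" and B: "B \<in> G1" for A B
    proof -
      have mem: "A \<in> J" "B \<in> J" using A B by (auto simp: G1_def)
      have "(\<lambda>k. nJ ((right_mult T ^^ n k) (A + B)) * norm (S (n k) g)) \<longlonglongrightarrow> 0"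
        if g: "g \<in> D2" for g
      proof (rule Lim_null_comparison)
        show "\<forall>\<^sub>F k in sequentially. norm (nJ ((right_mult T ^^ n k) (A + B)) * norm (S (n k) g))
            \<le> nJ ((right_mult T ^^ n k) A) * norm (S (n k) g)
              + nJ ((right_mult T ^^ n k) B) * norm (S (n k) g)"
          using mem by (auto simp: funpow_plus norm_nonneg funpow_mem add_mem norm_add
              mult_right_mono simp flip: distrib_right intro!: always_eventually)
        show "(\<lambda>k. nJ ((right_mult T ^^ n k) A) * norm (S (n k) g)
              + nJ ((right_mult T ^^ n k) B) * norm (S (n k) g)) \<longlonglongrightarrow> 0"
          using A B g by (auto simp: G1_def intro!: tendsto_add_zero)
      qed
      with mem show ?thesis by (simp add: G1_def add_mem)
    qed
    show "rank_one x f \<in> G1" if f: "f \<in> D1" for x f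
    proof -
      have "(\<lambda>k. norm x * (norm ((dual_adjoint T ^^ n k) f) * norm (S (n k) g))) \<longlonglongrightarrow> 0"
        if "g \<in> D2" for g
        using lim1[OF f that] by (rule tendsto_mult_right_zero)
      then show ?thesis
        using J f D_dual by (simp add: G1_def banach_ideal_rank_one right_mult_funpow_rank_one
            banach_ideal_norm_rank_one[OF J] adj_mem mult.assoc)
    qed
  qed
  moreover have "dense_on J nJ G2"
  proof (rule dense_on_ideal_if_rank_one[OF adm D(2)])
    show "G2 \<subseteq> J" by (auto simp: G2_def)
    show "0 \<in> G2"
      by (auto simp: G2_def zero_mem funpow_zero norm_zero intro!: exI[of _ "\<lambda>_. 0"])
    show "B + B' \<in> G2" if B: "B \<in> G2" and B': "B' \<in> G2" for B B'
    proof -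
      have mem: "B \<in> J" "B' \<in> J" using B B' by (auto simp: G2_def)
      obtain s where s: "\<And>k. s k \<in> J"
        "\<And>A. A \<in> G1 \<Longrightarrow> (\<lambda>k. nJ ((right_mult T ^^ n k) A) * nJ (s k)) \<longlonglongrightarrow> 0"
        "(\<lambda>k. nJ ((right_mult T ^^ n k) (s k) - B)) \<longlonglongrightarrow> 0"
        using B by (auto simp: G2_def)
      obtain s' where s': "\<And>k. s' k \<in> J"
        "\<And>A. A \<in> G1 \<Longrightarrow> (\<lambda>k. nJ ((right_mult T ^^ n k) A) * nJ (s' k)) \<longlonglongrightarrow> 0"
        "(\<lambda>k. nJ ((right_mult T ^^ n k) (s' k) - B')) \<longlonglongrightarrow> 0"
        using B' by (auto simp: G2_def)
      have "(\<lambda>k. nJ ((right_mult T ^^ n k) A) * nJ (s k + s' k)) \<longlonglongrightarrow> 0" if A: "A \<in> G1" for A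
      proof (rule Lim_null_comparison)
        have "A \<in> J" using A by (simp add: G1_def)
        then show "\<forall>\<^sub>F k in sequentially. norm (nJ ((right_mult T ^^ n k) A) * nJ (s k + s' k))
            \<le> nJ ((right_mult T ^^ n k) A) * nJ (s k) + nJ ((right_mult T ^^ n k) A) * nJ (s' k)"
          using s(1) s'(1) by (auto simp: norm_nonneg funpow_mem add_mem norm_add
              mult_left_mono simp flip: distrib_left intro!: always_eventually)
        show "(\<lambda>k. nJ ((right_mult T ^^ n k) A) * nJ (s k)
            + nJ ((right_mult T ^^ n k) A) * nJ (s' k)) \<longlonglongrightarrow> 0"
          using s(2) s'(2) A by (auto intro!: tendsto_add_zero)
      qed
      moreover have "(\<lambda>k. nJ ((right_mult T ^^ n k) (s k + s' k) - (B + B'))) \<longlonglongrightarrow> 0"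
      proof (rule Lim_null_comparison)
        have "nJ ((right_mult T ^^ n k) (s k + s' k) - (B + B'))
            \<le> nJ ((right_mult T ^^ n k) (s k) - B) + nJ ((right_mult T ^^ n k) (s' k) - B')" for k
          using norm_add[of "(right_mult T ^^ n k) (s k) - B" "(right_mult T ^^ n k) (s' k) - B'"]
            mem s(1) s'(1) by (simp add: funpow_plus funpow_mem diff_mem algebra_simps)
        then show "\<forall>\<^sub>F k in sequentially. norm (nJ ((right_mult T ^^ n k) (s k + s' k) - (B + B')))
            \<le> nJ ((right_mult T ^^ n k) (s k) - B) + nJ ((right_mult T ^^ n k) (s' k) - B')"
          using mem s(1) s'(1)
          by (auto simp: norm_nonneg funpow_mem add_mem diff_mem intro!: always_eventually)
        show "(\<lambda>k. nJ ((right_mult T ^^ n k) (s k) - B)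
            + nJ ((right_mult T ^^ n k) (s' k) - B')) \<longlonglongrightarrow> 0"
          using s(3) s'(3) by (rule tendsto_add_zero)
      qed
      ultimately show ?thesis
        using mem s(1) s'(1)
        by (auto simp: G2_def add_mem intro!: exI[of _ "\<lambda>k. s k + s' k"])
    qed
    show "rank_one y g \<in> G2" if g: "g \<in> D2" for y g
    proof -
      have "(\<lambda>k. nJ ((right_mult T ^^ n k) A) * nJ (rank_one y (S (n k) g))) \<longlonglongrightarrow> 0"
        if "A \<in> G1" for A
      proof -
        have "(\<lambda>k. norm y * (nJ ((right_mult T ^^ n k) A) * norm (S (n k) g))) \<longlonglongrightarrow> 0"
          using that g by (auto simp: G1_def intro!: tendsto_mult_right_zero)
        then show ?thesis
          using J S[OF g] by (simp add: banach_ideal_norm_rank_one[OF J] mult_ac)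
      qed
      moreover have "(\<lambda>k. nJ ((right_mult T ^^ n k) (rank_one y (S (n k) g)) - rank_one y g)) \<longlonglongrightarrow> 0"
        using tendsto_mult_right_zero[OF lim2[OF g], of "norm y"] J S[OF g] D_dual g

        by (simp add: clinear_ops_diff right_mult_funpow_rank_one rank_one_diff
            banach_ideal_norm_rank_one[OF J] adj_mem)
      ultimately show ?thesis
        using J S[OF g] D_dual g
        by (auto simp: G2_def banach_ideal_rank_one intro!: exI[of _ "\<lambda>k. rank_one y (S (n k) g)"])
    qed
  qed
  moreover have "\<exists>m. \<exists>s\<in>J. nJ ((right_mult T ^^ m) A) * nJ s < \<epsilon> \<and> nJ ((right_mult T ^^ m) s - B) < \<epsilon>"
    if A: "A \<in> G1" and B: "B \<in> G2" and \<epsilon>: "0 < \<epsilon>" for A B \<epsilon>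
  proof -
    obtain s where s: "\<And>k. s k \<in> J"
      "(\<lambda>k. nJ ((right_mult T ^^ n k) A) * nJ (s k)) \<longlonglongrightarrow> 0"
      "(\<lambda>k. nJ ((right_mult T ^^ n k) (s k) - B)) \<longlonglongrightarrow> 0"
      using A B by (auto simp: G2_def)
    have "\<forall>\<^sub>F k in sequentially. nJ ((right_mult T ^^ n k) A) * nJ (s k) < \<epsilon> \<and>
        nJ ((right_mult T ^^ n k) (s k) - B) < \<epsilon>"
      using order_tendstoD(2)[OF s(2) \<epsilon>] order_tendstoD(2)[OF s(3) \<epsilon>]
      by (rule eventually_conj)
    then show ?thesis
      using s(1) by (auto dest!: eventually_happens)
  qed
  ultimately show ?thesis
    using AB by (rule criterion_imp_transitive)
qed

section \<open>From a supercyclic multiplication to the criterion\<close>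

text \<open>
  Otherwise the kernel of $\psi$ would lie in that of $\varphi$, and $\varphi$ would be a multiple
  of $\psi$. Used in both orders, this gives vectors biorthogonal to two independent functionals.
\<close>

lemma functional_separating_kernel:
  fixes \<phi> \<psi> :: "'a::complex_normed_vector \<Rightarrow>\<^sub>L complex"
  assumes \<phi>: "\<phi> \<in> dual_space" and \<psi>: "\<psi> \<in> dual_space" and indep: "\<And>c. \<phi> \<noteq> c *\<^sub>C \<psi>"
  obtains x where "blinfun_apply \<phi> x = 1" "blinfun_apply \<psi> x = 0"
proof -
  have lin: "blinfun_apply f (c *\<^sub>C x) = c * blinfun_apply f x" if "f \<in> dual_space"
    for f :: "'a \<Rightarrow>\<^sub>L complex" and c x
    using that by (simp add: clinear_ops_def scaleC_complex_def)
  have "\<exists>x. blinfun_apply \<psi> x = 0 \<and> blinfun_apply \<phi> x \<noteq> 0"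
  proof (rule ccontr)
    assume "\<not> ?thesis"
    then have ker: "\<And>x. blinfun_apply \<psi> x = 0 \<Longrightarrow> blinfun_apply \<phi> x = 0" by blast
    obtain z where z: "blinfun_apply \<psi> z \<noteq> 0"
      using ker indep[of 0] by (metis blinfun_eqI complex_vector.scale_zero_left zero_blinfun.rep_eq)
    let ?c = "blinfun_apply \<phi> z / blinfun_apply \<psi> z"
    have multiple: "blinfun_apply \<phi> y = ?c * blinfun_apply \<psi> y" for y
    proof -
      have "blinfun_apply \<phi> (y - (blinfun_apply \<psi> y / blinfun_apply \<psi> z) *\<^sub>C z) = 0"
        using z by (intro ker) (simp add: blinfun.diff_right lin[OF \<psi>])
      then show ?thesis
        by (simp add: blinfun.diff_right lin[OF \<phi>] mult.commute)
    qed
    have "\<phi> = ?c *\<^sub>C \<psi>"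
      by (rule blinfun_eqI) (simp only: multiple[symmetric] scaleC_blinfun.rep_eq scaleC_complex_def)
    with indep show False by blast
  qed
  then obtain x where "blinfun_apply \<psi> x = 0" "blinfun_apply \<phi> x \<noteq> 0" by blast
  then show ?thesis
    using that[of "inverse (blinfun_apply \<phi> x) *\<^sub>C x"] by (simp add: lin[OF \<phi>] lin[OF \<psi>])
qed

text \<open>
  A dense projective orbit in $J$ is mapped onto a dense one in $X^* \oplus X^*$ by
  $B \mapsto (\varphi_1 \circ B, \varphi_2 \circ B)$. Linear independence of $\varphi_1, \varphi_2$
  is what makes this map onto.
\<close>

lemma right_mult_supercyclic_imp_adjoint_criterion:
  fixes T :: "'a::complex_normed_vector \<Rightarrow>\<^sub>L 'a" and \<phi>1 \<phi>2 :: "'a \<Rightarrow>\<^sub>L complex"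
  assumes J: "banach_ideal J nJ" and T: "T \<in> clinear_ops"
    and super: "supercyclic_on J nJ (right_mult T)"
    and \<phi>1: "\<phi>1 \<in> dual_space" and \<phi>2: "\<phi>2 \<in> dual_space"
    and indep: "\<And>c. \<phi>1 \<noteq> c *\<^sub>C \<phi>2" "\<And>c. \<phi>2 \<noteq> c *\<^sub>C \<phi>1"
  shows "supercyclicity_criterion_on dual_space norm (dual_adjoint T)"
proof -
  interpret J: operator_on J nJ "right_mult T"
    using J T by (rule operator_on_right_mult)
  interpret operator_on dual_space norm "dual_adjoint T"
    using T by (rule operator_on_dual_adjoint)
  obtain x1 where x1: "blinfun_apply \<phi>1 x1 = 1" "blinfun_apply \<phi>2 x1 = 0"
    using functional_separating_kernel[OF \<phi>1 \<phi>2 indep(1)] .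
  obtain x2 where x2: "blinfun_apply \<phi>2 x2 = 1" "blinfun_apply \<phi>1 x2 = 0"
    using functional_separating_kernel[OF \<phi>2 \<phi>1 indep(2)] .
  obtain A where A: "A \<in> J"
    and dense: "dense_on J nJ {a *\<^sub>C (right_mult T ^^ n) A | a n. True}"
    using super unfolding supercyclic_on_def by blast
  have Alin: "A \<in> clinear_ops" using A banach_ideal_subset[OF J] by blast
  show ?thesis
  proof (rule dense_pair_imp_criterion)
    show "\<phi>1 o\<^sub>L A \<in> dual_space" "\<phi>2 o\<^sub>L A \<in> dual_space"
      using \<phi>1 \<phi>2 Alin by (auto intro: clinear_ops_compose)
    fix f g :: "'a \<Rightarrow>\<^sub>L complex" and e :: real
    assume f: "f \<in> dual_space" and g: "g \<in> dual_space" and e: "0 < e"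
    define B where "B = rank_one x1 f + rank_one x2 g"
    have B: "B \<in> J"
      unfolding B_def using J f g by (intro J.add_mem banach_ideal_rank_one)
    define K where "K = norm \<phi>1 + norm \<phi>2 + 1"
    have K: "0 < K" "norm \<phi>1 \<le> K" "norm \<phi>2 \<le> K"
      by (auto simp: K_def add_nonneg_pos)
    obtain a n where an: "nJ (B - a *\<^sub>C (right_mult T ^^ n) A) < e / K"
      using dense B e K(1) unfolding dense_on_def
      by (auto dest!: bspec[of _ _ B] spec[of _ "e / K"])
    define E where "E = a *\<^sub>C (right_mult T ^^ n) A - B"
    have "E \<in> J" "nJ E < e / K"
      using an A B J.norm_diff_commute[OF B J.scale_mem[OF J.funpow_mem[OF A]]]
      by (auto simp: E_def J.diff_mem J.scale_mem J.funpow_mem)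
    then have E: "norm E < e / K"
      using banach_ideal_norm_le[OF J] by fastforce
    have est: "norm (a *\<^sub>C (dual_adjoint T ^^ n) (\<phi> o\<^sub>L A) - h) < e"
      if \<phi>: "\<phi> \<in> dual_space" "norm \<phi> \<le> K" and h: "\<phi> o\<^sub>L B = h" for \<phi> h
    proof -
      have "a *\<^sub>C (dual_adjoint T ^^ n) (\<phi> o\<^sub>L A) - h = \<phi> o\<^sub>L E"
        unfolding dual_adjoint_funpow_compose h[symmetric] E_def using \<phi>(1)
        by (intro blinfun_eqI)
          (simp add: clinear_ops_def scaleC_blinfun.rep_eq minus_blinfun.rep_eq blinfun.diff_right)
      then have "norm (a *\<^sub>C (dual_adjoint T ^^ n) (\<phi> o\<^sub>L A) - h) \<le> norm \<phi> * norm E"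
        by (simp add: norm_blinfun_compose)
      also have "\<dots> \<le> K * norm E"
        using \<phi>(2) by (simp add: mult_right_mono)
      also have "\<dots> < e"
        using E K(1) by (simp add: field_simps)
      finally show ?thesis .
    qed
    have comp: "\<phi> o\<^sub>L B = blinfun_apply \<phi> x1 *\<^sub>C f + blinfun_apply \<phi> x2 *\<^sub>C g"
      if "\<phi> \<in> dual_space" for \<phi> :: "'a \<Rightarrow>\<^sub>L complex"
      using that by (intro blinfun_eqI) (simp add: B_def clinear_ops_def plus_blinfun.rep_eq
          scaleC_blinfun.rep_eq rank_one.rep_eq blinfun.add_right scaleC_complex_def mult.commute)
    have "\<phi>1 o\<^sub>L B = f" "\<phi>2 o\<^sub>L B = g"
      using comp[OF \<phi>1] comp[OF \<phi>2] x1 x2 by (simp_all add: scaleC_one)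
    then show "\<exists>a n. norm (a *\<^sub>C (dual_adjoint T ^^ n) (\<phi>1 o\<^sub>L A) - f) < e \<and>
        norm (a *\<^sub>C (dual_adjoint T ^^ n) (\<phi>2 o\<^sub>L A) - g) < e"
      using est[OF \<phi>1 K(2)] est[OF \<phi>2 K(3)] by blast
  qed
qed

section \<open>A one-dimensional dual\<close>

text \<open>
  When $x \neq 0$, the map $c \mapsto c x$ scales distances by $\|x\|$, so coefficients of a
  convergent sequence on the line are Cauchy.
\<close>

lemma complex_line_closed:
  fixes x y :: "'a::complex_normed_vector"
  assumes "\<And>e. 0 < e \<Longrightarrow> \<exists>c. norm (y - c *\<^sub>C x) < e"
  shows "\<exists>c. y = c *\<^sub>C x"
proof (cases "x = 0")
  case True
  have "y = 0"
  proof (rule ccontr)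
    assume "y \<noteq> 0"
    then show False using assms[of "norm y"] True by simp
  qed
  then show ?thesis using True by simp
next
  case False
  have "\<forall>k. \<exists>c. norm (y - c *\<^sub>C x) < inverse (real (Suc k))"
    using assms by simp
  then obtain c where c: "\<And>k. norm (y - c k *\<^sub>C x) < inverse (real (Suc k))" by metis
  have lim: "(\<lambda>k. c k *\<^sub>C x) \<longlonglongrightarrow> y"
  proof (rule Lim_transform_bound[OF _ LIMSEQ_inverse_real_of_nat, THEN LIM_zero_cancel])
    show "\<forall>\<^sub>F k in sequentially. norm (c k *\<^sub>C x - y) \<le> norm (inverse (real (Suc k)))"
      using c by (auto simp: norm_minus_commute[of _ y] less_imp_le intro!: always_eventually)
  qed
  have "Cauchy c"
  proof (rule metric_CauchyI)
    fix e :: real assume "0 < e"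
    then obtain M where M: "\<And>m n. m \<ge> M \<Longrightarrow> n \<ge> M \<Longrightarrow> dist (c m *\<^sub>C x) (c n *\<^sub>C x) < e * norm x"
      using LIMSEQ_imp_Cauchy[OF lim] False unfolding Cauchy_def
      by (meson mult_pos_pos zero_less_norm_iff)
    have "dist (c m) (c n) < e" if "m \<ge> M" "n \<ge> M" for m n
      using M[OF that] False
      by (simp add: dist_norm norm_scaleC flip: complex_vector.scale_left_diff_distrib)
    then show "\<exists>M. \<forall>m\<ge>M. \<forall>n\<ge>M. dist (c m) (c n) < e" by blast
  qed
  then obtain l where "c \<longlonglongrightarrow> l"
    using Cauchy_convergent convergent_def by blast
  then have "(\<lambda>k. c k *\<^sub>C x) \<longlonglongrightarrow> l *\<^sub>C x"
    by (intro bounded_bilinear.tendsto[OF bounded_bilinear_scaleC] tendsto_const)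
  then show ?thesis
    using LIMSEQ_unique lim by blast
qed

lemma not_line_if_complex_dim_gt_one:
  fixes x :: "'a::complex_normed_vector"
  assumes dim: "complex_dim_gt_one TYPE('a)"
  obtains y :: 'a where "\<And>c. y \<noteq> c *\<^sub>C x"
proof -
  obtain B :: "'a set" where B: "complex_vector.independent B" "finite B \<longrightarrow> 1 < card B"
    using dim unfolding complex_dim_gt_one_def by blast
  have "\<not> B \<subseteq> complex_vector.span {x}"
    using complex_vector.independent_span_bound[OF _ B(1), of "{x}"] B(2) by auto
  then obtain y where "y \<notin> complex_vector.span {x}" by blast
  moreover have "c *\<^sub>C x \<in> complex_vector.span {x}" for c
    by (simp add: complex_vector.span_scale complex_vector.span_base)
  ultimately show ?thesis
    using that by metis
qed

text \<open>
  Fix $z$ with $\varphi(z) = 1$. A finite rank operator vanishes on the kernel of $\varphi$, hence so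
  does every $A \in J$, which gives $A w = \varphi(w) A z$. So $R_T^n A$ always sends $z$ into the
  line through $A z$. If $A$ were supercyclic, approximating $y \otimes \varphi$ and evaluating at
  $z$ would put every $y$ on that line.
\<close>

lemma not_supercyclic_right_mult_if_dual_line:
  fixes J :: "('a::complex_normed_vector \<Rightarrow>\<^sub>L 'a) set"
  assumes dim: "complex_dim_gt_one TYPE('a)"
    and adm: "admissible_banach_ideal J nJ" and T: "T \<in> clinear_ops"
    and \<phi>: "\<phi> \<in> dual_space" "\<phi> \<noteq> 0"
    and line: "\<And>f :: 'a \<Rightarrow>\<^sub>L complex. f \<in> dual_space \<Longrightarrow> \<exists>c. f = c *\<^sub>C \<phi>"
  shows "\<not> supercyclic_on J nJ (right_mult T)"
proof
  assume "supercyclic_on J nJ (right_mult T)"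
  then obtain A where A: "A \<in> J"
    and dense: "dense_on J nJ {a *\<^sub>C (right_mult T ^^ n) A | a n. True}"
    unfolding supercyclic_on_def by blast
  have J: "banach_ideal J nJ" and fin: "dense_on J nJ finite_rank_ops"
    using adm by (auto simp: admissible_banach_ideal_def)
  interpret operator_on J nJ "right_mult T"
    using J T by (rule operator_on_right_mult)
  have "0 \<in> (dual_space :: ('a \<Rightarrow>\<^sub>L complex) set)"
    using clinear_ops_subspace by (rule complex_vector.subspace_0)
  then obtain z where z: "blinfun_apply \<phi> z = 1"
    using functional_separating_kernel[OF \<phi>(1), of 0] \<phi>(2) by auto
  have apply_le: "norm (blinfun_apply S w) \<le> nJ S * norm w" if "S \<in> J" for S w
    using norm_blinfun[of S w] banach_ideal_norm_le[OF J that]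
    by (meson mult_right_mono norm_ge_zero order_trans)
  have ker: "blinfun_apply A w = 0" if w: "blinfun_apply \<phi> w = 0" for w
  proof (rule ccontr)
    assume nz: "blinfun_apply A w \<noteq> 0"
    then have pos: "0 < norm w" by auto
    then obtain F where F: "F \<in> finite_rank_ops" "nJ (A - F) < norm (blinfun_apply A w) / norm w"
      using fin A nz unfolding dense_on_def by (meson divide_pos_pos zero_less_norm_iff)
    have "blinfun_apply F w = 0"
      using F(1) unfolding finite_rank_ops_def
    proof (induction rule: complex_vector.span_induct_alt)
      case (step c R F)
      then obtain x f where R: "R = rank_one x f" "f \<in> dual_space" by blast
      obtain b where "f = b *\<^sub>C \<phi>" using line R(2) by blast
      then show ?case
        using step R w by (simp add: plus_blinfun.rep_eq scaleC_blinfun.rep_eq rank_one.rep_eq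
            scaleC_complex_def)
    qed simp
    moreover have "A - F \<in> J"
      using A F fin by (auto simp: dense_on_def intro: diff_mem)
    ultimately have "norm (blinfun_apply A w) \<le> nJ (A - F) * norm w"
      using apply_le[of "A - F" w] by (simp add: minus_blinfun.rep_eq)
    then show False
      using F(2) pos by (simp add: field_simps)
  qed
  have A_line: "blinfun_apply A w = blinfun_apply \<phi> w *\<^sub>C blinfun_apply A z" for w
  proof -
    have "blinfun_apply A (w - blinfun_apply \<phi> w *\<^sub>C z) = 0"
      using \<phi>(1) z
      by (intro ker) (simp add: clinear_ops_def blinfun.diff_right scaleC_complex_def)
    then show ?thesis
      using A banach_ideal_subset[OF J] by (auto simp: clinear_ops_def blinfun.diff_right)
  qed
  have orbit: "blinfun_apply ((right_mult T ^^ n) A) w = blinfun_apply A ((blinfun_apply T ^^ n) w)"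
    for n w
  proof (induction n arbitrary: w)
    case (Suc n)
    have "blinfun_apply ((right_mult T ^^ Suc n) A) w
        = blinfun_apply ((right_mult T ^^ n) A) (blinfun_apply T w)"
      by (simp add: right_mult_def)
    with Suc show ?case by (simp add: funpow_swap1)
  qed simp
  have "\<exists>c. y = c *\<^sub>C blinfun_apply A z" for y
  proof (rule complex_line_closed)
    fix e :: real assume e: "0 < e"
    have R: "rank_one y \<phi> \<in> J" using J \<phi>(1) by (rule banach_ideal_rank_one)
    have pos: "0 < norm z" using z by auto
    then obtain a n where an: "nJ (rank_one y \<phi> - a *\<^sub>C (right_mult T ^^ n) A) < e / norm z"
      using dense R e unfolding dense_on_def
      by (auto dest!: bspec[of _ _ "rank_one y \<phi>"] spec[of _ "e / norm z"])
    let ?c = "a * blinfun_apply \<phi> ((blinfun_apply T ^^ n) z)"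
    have "blinfun_apply (rank_one y \<phi> - a *\<^sub>C (right_mult T ^^ n) A) z
        = y - ?c *\<^sub>C blinfun_apply A z"
      by (simp add: minus_blinfun.rep_eq scaleC_blinfun.rep_eq rank_one.rep_eq z scaleC_one orbit
          A_line[of "(blinfun_apply T ^^ n) z"] scaleC_scaleC)
    then have "norm (y - ?c *\<^sub>C blinfun_apply A z)
        \<le> nJ (rank_one y \<phi> - a *\<^sub>C (right_mult T ^^ n) A) * norm z"
      using apply_le[OF diff_mem[OF R scale_mem[OF funpow_mem[OF A]]], of a n z] by simp
    also have "\<dots> < e"
      using an pos by (simp add: field_simps)
    finally show "\<exists>c. norm (y - c *\<^sub>C blinfun_apply A z) < e" by blast
  qed
  then show False
    using not_line_if_complex_dim_gt_one[OF dim, of "blinfun_apply A z"] by metis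
qed

section \<open>The equivalence\<close>

theorem theorem2p4:
  fixes J :: "('a::complex_banach \<Rightarrow>\<^sub>L 'a) set"
    and nJ :: "('a \<Rightarrow>\<^sub>L 'a) \<Rightarrow> real"
    and T :: "'a \<Rightarrow>\<^sub>L 'a"
  assumes "complex_dim_gt_one TYPE('a)"
    and "separable_on (dual_space :: ('a \<Rightarrow>\<^sub>L complex) set) norm"
    and "admissible_banach_ideal J nJ"
    and "separable_on J nJ"
    and "T \<in> clinear_ops"
  shows "supercyclicity_criterion_on (dual_space :: ('a \<Rightarrow>\<^sub>L complex) set) norm (dual_adjoint T)
    \<longleftrightarrow> supercyclic_on J nJ (right_mult T)"
proof
  have J: "banach_ideal J nJ"
    using assms(3) by (simp add: admissible_banach_ideal_def)
  {
    assume "supercyclicity_criterion_on (dual_space :: ('a \<Rightarrow>\<^sub>L complex) set) norm (dual_adjoint T)"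
    then show "supercyclic_on J nJ (right_mult T)"
      using operator_on.transitive_imp_supercyclic[OF operator_on_right_mult[OF J assms(5)] assms(4)]
        adjoint_criterion_imp_right_mult_transitive[OF assms(3,5)] by blast
  next
    assume super: "supercyclic_on J nJ (right_mult T)"
    interpret dual: operator_on "dual_space :: ('a \<Rightarrow>\<^sub>L complex) set" norm "dual_adjoint T"
      using assms(5) by (rule operator_on_dual_adjoint)
    show "supercyclicity_criterion_on (dual_space :: ('a \<Rightarrow>\<^sub>L complex) set) norm (dual_adjoint T)"
    proof (cases "\<exists>\<phi>\<in>(dual_space :: ('a \<Rightarrow>\<^sub>L complex) set). \<forall>f\<in>dual_space. \<exists>c. f = c *\<^sub>C \<phi>")
      case True
      then obtain \<phi> :: "'a \<Rightarrow>\<^sub>L complex" where \<phi>: "\<phi> \<in> dual_space"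
        and line: "\<And>f. f \<in> dual_space \<Longrightarrow> \<exists>c. f = c *\<^sub>C \<phi>" by blast
      then have "\<phi> = 0"
        using not_supercyclic_right_mult_if_dual_line[OF assms(1,3,5) \<phi> _ line] super by blast
      \<comment> \<open>Then $X^*$ is trivial, and the pair $(0, 0)$ already has a dense orbit.\<close>
      then have zero: "f = 0" if "f \<in> dual_space" for f :: "'a \<Rightarrow>\<^sub>L complex"
        using line[OF that] by auto
      show ?thesis
        by (rule dual.dense_pair_imp_criterion[OF dual.zero_mem dual.zero_mem])
          (auto dest!: zero simp: dual.funpow_zero)
    next
      case False
      then obtain \<phi>2 :: "'a \<Rightarrow>\<^sub>L complex" where \<phi>2: "\<phi>2 \<in> dual_space" "\<And>c. \<phi>2 \<noteq> c *\<^sub>C 0"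
        using dual.zero_mem by blast
      then obtain \<phi>1 :: "'a \<Rightarrow>\<^sub>L complex" where \<phi>1: "\<phi>1 \<in> dual_space" "\<And>c. \<phi>1 \<noteq> c *\<^sub>C \<phi>2"
        using False by blast
      have "\<phi>2 \<noteq> c *\<^sub>C \<phi>1" for c
      proof
        assume eq: "\<phi>2 = c *\<^sub>C \<phi>1"
        then have "c \<noteq> 0" using \<phi>2(2)[of 0] by auto
        then have "\<phi>1 = inverse c *\<^sub>C \<phi>2"
          by (simp add: eq scaleC_scaleC scaleC_one)
        with \<phi>1(2) show False by blast
      qed
      then show ?thesis
        using right_mult_supercyclic_imp_adjoint_criterion[OF J assms(5) super \<phi>1(1) \<phi>2(1) \<phi>1(2)]
        by blast
    qed
  }
qed

end
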